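(* Let $n \geq 0$ be an integer and let $m \in \{1,\ldots,2^n\}$. Let $\kappa=1$ if $n$ is even and $\kappa=2$ if $n$ is odd, and let $c$ be the positive integer such that $\kappa c(c-1) \leq m < \kappa c(c+1)$. Then \[\Phi(n,m)=\sqrt{\kappa 2^{n}}\Bigl(2c-1+2\delta_{2 \kappa c}\bigl(m-\kappa c(c-1)\bigr)\Bigr)-m,\] where, for any positive integer $k$, $\delta_k: \{0,\ldots,k\} \rightarrow \{y \in \mathbb{Q}:0\leq y \leq 1\}$ is the function recursively defined by $\delta_1(x)=x$ and, for $k \geq 2$, \[ \delta_k(x) = \begin{cases} \frac{1}{2}\delta_{\lfloor k/2\rfloor}(x) & \text{if } x \in \{0,\ldots,\lfloor\frac{k}{2}\rfloor-1\}, \\ \frac{1}{2}+\frac{1}{2}\delta_{\lceil k/2 \rceil}(x-\lfloor\frac{k}{2}\rfloor) &\text{if } x \in \{\lfloor\frac{k}{2}\rfloor,\ldots,k\}. \end{cases} \]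
   Context: For a nonnegative integer $n$, $[n]=\{1,\ldots,n\}$ (so $[0]=\emptyset$), and $2^X$ denotes the power set of a set $X$. For a family $\mathcal{F}$ of subsets of $[n]$, let $\mathcal{F}^{\downarrow}=\{S \subseteq [n]: S \subseteq F \text{ for some } F \in \mathcal{F}\}$, $\mathcal{F}^{\uparrow}=\{S \subseteq [n]: F \subseteq S \text{ for some } F \in \mathcal{F}\}$ and $\mathcal{F}^{\updownarrow}=\mathcal{F}^{\uparrow}\cup\mathcal{F}^{\downarrow}$. For nonnegative integers $m,n$ with $m \leq 2^n$, let $\Phi(n,m)=\min\{|\mathcal{F}^{\updownarrow}|: \mathcal{F}\subseteq 2^{[n]},\ |\mathcal{F}|=m\}$. *)

theory Defs
  imports Complex_Main
begin

definition down_closure :: "nat \<Rightarrow> nat set set \<Rightarrow> nat set set" where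
  "down_closure n \<F> = {S. S \<subseteq> {1..n} \<and> (\<exists>F\<in>\<F>. S \<subseteq> F)}"

definition up_closure :: "nat \<Rightarrow> nat set set \<Rightarrow> nat set set" where
  "up_closure n \<F> = {S. S \<subseteq> {1..n} \<and> (\<exists>F\<in>\<F>. F \<subseteq> S)}"

definition updown_closure :: "nat \<Rightarrow> nat set set \<Rightarrow> nat set set" where
  "updown_closure n \<F> = up_closure n \<F> \<union> down_closure n \<F>"

text \<open>The set below is finite, and it is nonempty exactly when \<open>m \<le> 2 ^ n\<close>;
  for larger \<open>m\<close> the value is unspecified.\<close>

definition Phi :: "nat \<Rightarrow> nat \<Rightarrow> nat" where
  "Phi n m = Min {card (updown_closure n \<F>) | \<F>. \<F> \<subseteq> Pow {1..n} \<and> card \<F> = m}"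

text \<open>Only arguments with \<open>0 < k\<close> and \<open>x \<le> k\<close> are meaningful, and the recursion stays
  within that range; the values elsewhere (in particular at \<open>k = 0\<close>) are arbitrary.
  The floor and ceiling of \<open>k / 2\<close> are \<open>k div 2\<close> and \<open>(k + 1) div 2\<close>.\<close>

fun delta :: "nat \<Rightarrow> nat \<Rightarrow> rat" where
  "delta k x =
    (if k = 0 then 0
     else if k = 1 then of_nat x
     else if x < k div 2 then 1 / 2 * delta (k div 2) x
     else 1 / 2 + 1 / 2 * delta ((k + 1) div 2) (x - k div 2))"

declare delta.simps [simp del]

lemma delta_range: "x \<le> k \<Longrightarrow> 0 \<le> delta k x \<and> delta k x \<le> 1"
proof (induction k x rule: delta.induct)
  case (1 k x)
  consider "k = 0" | "k = 1" | "k \<ge> 2" "x < k div 2" | "k \<ge> 2" "x \<ge> k div 2"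
    by linarith
  then show ?case
  proof cases
    case 3
    then show ?thesis
      using "1.IH"(1) by (subst (1 2) delta.simps) simp
  next
    case 4
    moreover have "x - k div 2 \<le> (k + 1) div 2"
      using "1.prems" by linarith
    ultimately show ?thesis
      using "1.IH"(2) by (subst (1 2) delta.simps) simp
  qed (use "1.prems" in \<open>auto simp: delta.simps\<close>)
qed

end

theory Submission
  imports Defs
begin

text \<open>For a family of \<open>m\<close> sets let \<open>U\<close> be its up-closure and \<open>D\<close> its down-closure. The family lies in
\<open>U \<inter> D\<close>, so the number of sets comparable to a member is \<open>|U| + |D| - |U \<inter> D|\<close> with
\<open>|U \<inter> D| \<ge> m\<close>. Conversely, any \<open>m\<close> sets chosen in the intersection of an up-set with a down-set
have at most \<open>|U| + |D| - m\<close> comparable sets. Hence everything rests on how large \<open>|U \<inter> D|\<close> can be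
when \<open>|U| = a\<close> and \<open>|D| = b\<close> are prescribed.

Kleitman's inequality \<open>|U \<inter> D| \<le> ab / 2 ^ n\<close> loses too much by integrality. The exact maximum
is the function \<open>vdc n a b\<close> below, which satisfies a recursion on \<open>n\<close>: split all families by
membership of the last element. The sections of an up-set grow and those of a down-set shrink,
and the inductive step is the inequality \<open>vdc_merge\<close>, which says that merging two such oppositely
ordered pairs \<open>(a0, b0)\<close> and \<open>(a1, b1)\<close> never beats \<open>vdc\<close>. Two explicit chains of families,
\<open>up_chain\<close> and \<open>down_chain\<close>, follow the recursion and attain the maximum for all \<open>a\<close> and \<open>b\<close> at
once.

What is left is arithmetic: find the least sum \<open>a + b\<close> with \<open>vdc n a b \<ge> m\<close>. As \<open>vdc\<close> can also be
unfolded along its first argument, two unfoldings give a recursion from \<open>n\<close> to \<open>n + 2\<close>, and with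
it an upper bound \<open>env n (a + b)\<close> depending on the sum only (\<open>vdc_le_env\<close>). Write
\<open>n = 2 * k + e\<close> with \<open>e \<le> 1\<close>, \<open>\<kappa> = 2 ^ e\<close> and \<open>K = 2 ^ k\<close>. Closed forms (\<open>env_block\<close>,
\<open>vdc_product\<close>) show that this bound is attained when \<open>a = c * (\<kappa> * K)\<close> is a suitable multiple of
\<open>\<kappa> * K\<close>; with \<open>b = d * K + r\<close> the value is \<open>c * d + vdc k c r\<close>. Finally, binary search is what
the recursion of \<open>delta\<close> does: \<open>2 ^ k * delta c x\<close> is the least \<open>r\<close> with
\<open>vdc k c r \<ge> x\<close> (\<open>delta_vdc_galois\<close>). Writing \<open>m = c * d + x\<close> with \<open>x < c\<close>, the least sum is
therefore \<open>(\<kappa> * c + d + delta c x) * K\<close>, which is the claimed value plus \<open>m\<close>.\<close>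

section \<open>The maximal intersection as an arithmetic function\<close>

text \<open>For \<open>a \<le> 2 ^ n\<close> this is the number of points of a van der Corput set in a box: the number of
  \<open>j < a\<close> such that reversing the \<open>n\<close> binary digits of \<open>2 ^ n - 1 - j\<close> gives a number below \<open>b\<close>.
  The truncated subtraction lets one equation cover both halves of the range of \<open>b\<close>, because
  \<open>vdc n a 0 = 0\<close> and \<open>vdc n a b = a\<close> as soon as \<open>b \<ge> 2 ^ n\<close>.\<close>

fun vdc :: "nat \<Rightarrow> nat \<Rightarrow> nat \<Rightarrow> nat" where
  "vdc 0 a b = (if b = 0 then 0 else a)"
| "vdc (Suc n) a b = vdc n (a div 2) b + vdc n ((a + 1) div 2) (b - 2 ^ n)"

lemma vdc_zero_left [simp]: "vdc n 0 b = 0"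
  by (induction n arbitrary: b) auto

lemma vdc_zero_right [simp]: "vdc n a 0 = 0"
  by (induction n arbitrary: a) auto

lemma vdc_full: "2 ^ n \<le> b \<Longrightarrow> vdc n a b = a"
proof (induction n arbitrary: a b)
  case (Suc n)
  then have "2 ^ n \<le> b" "2 ^ n \<le> b - 2 ^ n" by auto
  then show ?case using Suc.IH by simp
qed auto

lemma vdc_Suc_low: "b \<le> 2 ^ n \<Longrightarrow> vdc (Suc n) a b = vdc n (a div 2) b"
  by simp

lemma vdc_Suc_high:
  "2 ^ n \<le> b \<Longrightarrow> vdc (Suc n) a b = a div 2 + vdc n ((a + 1) div 2) (b - 2 ^ n)"
  by (simp add: vdc_full)

lemma vdc_half_le: "vdc n (a div 2) b \<le> vdc (Suc n) a b"
  by simp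

lemma vdc_mono: "a \<le> a' \<Longrightarrow> b \<le> b' \<Longrightarrow> vdc n a b \<le> vdc n a' b'"
proof (induction n arbitrary: a a' b b')
  case (Suc n)
  then show ?case by (auto intro!: add_mono Suc.IH div_le_mono diff_le_mono)
qed auto

text \<open>Exactly one of the two halves of \<open>a\<close> grows when \<open>a\<close> increases by one.\<close>

lemma vdc_Suc_left_le: "vdc n (Suc a) b \<le> Suc (vdc n a b)"
proof (induction n arbitrary: a b)
  case (Suc n)
  show ?case
  proof (cases "even a")
    case True
    then have "Suc a div 2 = a div 2" "(Suc a + 1) div 2 = Suc ((a + 1) div 2)"
      by presburger+
    then show ?thesis using Suc.IH[of "(a + 1) div 2" "b - 2 ^ n"] by simp
  next
    case False
    then have "Suc a div 2 = Suc (a div 2)" "(Suc a + 1) div 2 = (a + 1) div 2"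
      by presburger+
    then show ?thesis using Suc.IH[of "a div 2" b] by simp
  qed
qed auto

lemma vdc_lipschitz: "vdc n (a + t) b \<le> vdc n a b + t"
proof (induction t)
  case (Suc t)
  then show ?case using vdc_Suc_left_le[of n "a + t" b] by simp
qed auto

lemma vdc_le_left: "vdc n a b \<le> a"
  using vdc_lipschitz[of n 0 a b] by simp

lemma vdc_le_right: "a \<le> 2 ^ n \<Longrightarrow> vdc n a b \<le> b"
proof (induction n arbitrary: a b)
  case (Suc n)
  show ?case
  proof (cases "b \<le> 2 ^ n")
    case True
    with Suc show ?thesis by simp
  next
    case False
    have "a div 2 \<le> 2 ^ n" "(a + 1) div 2 \<le> 2 ^ n" using Suc.prems by auto
    then show ?thesis
      using False Suc.IH[of "(a + 1) div 2" "b - 2 ^ n"]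
      by (subst vdc_Suc_high) auto
  qed
qed auto

text \<open>A nonempty up-set contains the set of all \<open>n\<close> elements, so only the full down-set can contain it.\<close>

lemma vdc_less_left: "0 < a \<Longrightarrow> b < 2 ^ n \<Longrightarrow> vdc n a b < a"
proof (induction n arbitrary: a b)
  case (Suc n)
  show ?case
  proof (cases "b < 2 ^ n")
    case True
    have "vdc (Suc n) a b \<le> a div 2" using True vdc_le_left by simp
    with Suc.prems show ?thesis by simp
  next
    case False
    have "vdc n ((a + 1) div 2) (b - 2 ^ n) < (a + 1) div 2"
      using False Suc.prems by (intro Suc.IH) auto
    moreover have "a div 2 + (a + 1) div 2 = a" by presburger
    ultimately show ?thesis using False vdc_Suc_high[of n b a] by linarith
  qed
qed auto

text \<open>The van der Corput set is symmetric: as digit reversal commutes with complementing all digits,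
exchanging the two coordinates maps the set to itself. So \<open>vdc\<close> also unfolds along the leading digit of \<open>a\<close> while halving \<open>b\<close>. This lemma and the
next one are the mirror images of \<open>vdc_Suc_low\<close> and \<open>vdc_Suc_high\<close>.\<close>

lemma vdc_Suc_left_low: "a \<le> 2 ^ n \<Longrightarrow> vdc (Suc n) a b = vdc n a (b div 2)"
proof (induction n arbitrary: a b)
  case 0
  then have "a = 0 \<or> a = 1" by auto
  then show ?case by auto
next
  case (Suc n)
  have le: "a div 2 \<le> 2 ^ n" "(a + 1) div 2 \<le> 2 ^ n" using Suc.prems by auto
  have half: "(b - 2 ^ Suc n) div 2 = b div 2 - 2 ^ n" by simp
  have "vdc (Suc (Suc n)) a b = vdc (Suc n) (a div 2) b + vdc (Suc n) ((a + 1) div 2) (b - 2 ^ Suc n)"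
    by (rule vdc.simps)
  also have "\<dots> = vdc n (a div 2) (b div 2) + vdc n ((a + 1) div 2) (b div 2 - 2 ^ n)"
    by (simp only: Suc.IH[OF le(1)] Suc.IH[OF le(2)] half)
  finally show ?case by simp
qed

lemma vdc_Suc_left_high:
  "t \<le> 2 ^ n \<Longrightarrow> b \<le> 2 ^ Suc n \<Longrightarrow>
    vdc (Suc n) (2 ^ n + t) b = b div 2 + vdc n t ((b + 1) div 2)"
proof (induction n arbitrary: t b)
  case 0
  then have "t = 0 \<or> t = 1" "b = 0 \<or> b = 1 \<or> b = 2" by auto
  then show ?case by auto
next
  case (Suc n)
  have le: "t div 2 \<le> 2 ^ n" "(t + 1) div 2 \<le> 2 ^ n" using Suc.prems by auto
  have halves: "(2 ^ Suc n + t) div 2 = 2 ^ n + t div 2"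
    "(2 ^ Suc n + t + 1) div 2 = 2 ^ n + (t + 1) div 2" by auto
  show ?case
  proof (cases "b \<le> 2 ^ Suc n")
    case True
    have "vdc (Suc (Suc n)) (2 ^ Suc n + t) b = vdc (Suc n) (2 ^ n + t div 2) b"
      by (simp only: vdc_Suc_low[OF True] halves)
    also have "\<dots> = b div 2 + vdc n (t div 2) ((b + 1) div 2)"
      by (rule Suc.IH[OF le(1) True])
    also have "vdc n (t div 2) ((b + 1) div 2) = vdc (Suc n) t ((b + 1) div 2)"
      using True by (subst vdc_Suc_low) auto
    finally show ?thesis .
  next
    case False
    have half: "(b - 2 ^ Suc n + 1) div 2 = (b + 1) div 2 - 2 ^ n"
      using False by simp
    have "vdc (Suc (Suc n)) (2 ^ Suc n + t) b =
        2 ^ n + t div 2 + vdc (Suc n) (2 ^ n + (t + 1) div 2) (b - 2 ^ Suc n)"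
      using vdc_Suc_high[of "Suc n" b "2 ^ Suc n + t"] False by (simp only: halves)
    also have "vdc (Suc n) (2 ^ n + (t + 1) div 2) (b - 2 ^ Suc n) =
        (b - 2 ^ Suc n) div 2 + vdc n ((t + 1) div 2) ((b + 1) div 2 - 2 ^ n)"
      using Suc.IH[OF le(2), of "b - 2 ^ Suc n"] Suc.prems by (simp only: half) simp
    also have "2 ^ n + t div 2 + \<dots> = b div 2 + (t div 2 + vdc n ((t + 1) div 2) ((b + 1) div 2 - 2 ^ n))"
      using False by simp
    also have "t div 2 + vdc n ((t + 1) div 2) ((b + 1) div 2 - 2 ^ n) = vdc (Suc n) t ((b + 1) div 2)"
      using False by (subst vdc_Suc_high) auto
    finally show ?thesis .
  qed
qed

section \<open>Merging oppositely ordered pairs\<close>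

declare vdc.simps(2) [simp del]

text \<open>Among the intervals of \<open>b'\<close> consecutive second coordinates, the initial one contains the fewest of
the points with \<open>j < a\<close>. The first part says so for the interval that follows the initial \<open>b\<close>
coordinates; the second part is the same statement when that interval wraps around past \<open>2 ^ n\<close>.
Each part uses the other at the previous level, so they are proved together; the ordering of \<open>b\<close>
and \<open>b'\<close> only halves the number of cases.\<close>

lemma vdc_add_right_aux:
  assumes "b \<le> 2 ^ n" "b' \<le> b"
  shows "(b + b' \<le> 2 ^ n \<longrightarrow> vdc n a b + vdc n a b' \<le> vdc n a (b + b')) \<and>
    (2 ^ n \<le> b + b' \<longrightarrow> vdc n a b + vdc n a b' \<le> a + vdc n a (b + b' - 2 ^ n))"
  using assms
proof (induction n arbitrary: a b b')
  case 0
  then show ?case by auto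
next
  case (Suc n)
  define h where "h = (2::nat) ^ n"
  define p q where "p = a div 2" and "q = (a + 1) div 2"
  have S: "vdc n a b + vdc n a b' \<le> vdc n a (b + b')" if "b + b' \<le> h" for a b b'
    using Suc.IH[of b b' a] Suc.IH[of b' b a] that unfolding h_def
    by (cases "b' \<le> b") (auto simp: add.commute)
  have S2: "vdc n a b + vdc n a b' \<le> a + vdc n a (b + b' - h)"
    if "h \<le> b + b'" "b \<le> h" "b' \<le> h" for a b b'
    using Suc.IH[of b b' a] Suc.IH[of b' b a] that unfolding h_def
    by (cases "b' \<le> b") (auto simp: add.commute)
  have pq: "p + q = a" "p \<le> q" "q \<le> p + 1" unfolding p_def q_def by presburger+
  have q_p: "vdc n q b + p \<le> vdc n p b + q" for b
    using vdc_lipschitz[of n p "q - p" b] pq(2) by simp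
  have p_q: "vdc n p b \<le> vdc n q b" for b
    using pq by (intro vdc_mono) auto
  have low: "vdc (Suc n) a b = vdc n p b" if "b \<le> h" for b
    using that unfolding h_def p_def by (rule vdc_Suc_low)
  have high: "vdc (Suc n) a b = p + vdc n q (b - h)" if "h \<le> b" for b
    using that unfolding h_def p_def q_def by (rule vdc_Suc_high)
  have N: "(2::nat) ^ Suc n = 2 * h" by (simp add: h_def)
  have bnds: "b \<le> 2 * h" "b' \<le> b" using Suc.prems N by auto
  show ?case unfolding N
  proof (intro conjI impI)
    assume sum: "b + b' \<le> 2 * h"
    consider "b + b' \<le> h" | "h \<le> b + b'" "b \<le> h" | "h \<le> b"
      by linarith
    then show "vdc (Suc n) a b + vdc (Suc n) a b' \<le> vdc (Suc n) a (b + b')"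
    proof cases
      case 1
      then show ?thesis using S[of b b' p] by (simp add: low)
    next
      case 2
      then show ?thesis
        using S2[of b b' p] p_q[of "b + b' - h"] bnds by (simp add: low high)
    next
      case 3
      then show ?thesis
        using S[of "b - h" b' q] p_q[of b'] bnds sum by (simp add: low high le_diff_conv)
    qed
  next
    assume sum: "2 * h \<le> b + b'"
    then have bh: "h \<le> b" using bnds by linarith
    consider "b' \<le> h" | "h \<le> b'" "b + b' \<le> 3 * h" | "3 * h \<le> b + b'"
      by linarith
    then show "vdc (Suc n) a b + vdc (Suc n) a b' \<le> a + vdc (Suc n) a (b + b' - 2 * h)"
    proof cases
      case 1
      have eq: "b - h + b' - h = b + b' - 2 * h" using bh sum by linarith
      have "vdc n p (b - h) + vdc n p b' \<le> p + vdc n p (b - h + b' - h)"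
        using 1 bh bnds sum by (intro S2) auto
      then show ?thesis
        using q_p[of "b - h"] bnds sum pq 1 bh unfolding eq by (simp add: low high)
    next
      case 2
      have eq: "b - h + (b' - h) = b + b' - 2 * h" using 2 bh by linarith
      have "vdc n q (b - h) + vdc n q (b' - h) \<le> vdc n q (b - h + (b' - h))"
        using 2 bh by (intro S) auto
      then show ?thesis
        using q_p[of "b + b' - 2 * h"] bnds sum pq 2 bh unfolding eq by (simp add: low high)
    next
      case 3
      have eq: "b - h + (b' - h) - h = b + b' - 3 * h" using 3 bnds by linarith
      have b'h: "h \<le> b'" using 3 bnds by linarith
      have "vdc n q (b - h) + vdc n q (b' - h) \<le> q + vdc n q (b - h + (b' - h) - h)"
        using 3 bnds by (intro S2) auto
      then show ?thesis
        using bnds sum pq 3 bh b'h unfolding eq by (simp add: high)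
    qed
  qed
qed

lemma vdc_add_right_below:
  assumes "b + b' \<le> 2 ^ n"
  shows "vdc n a b + vdc n a b' \<le> vdc n a (b + b')"
  using vdc_add_right_aux[of b n b' a] vdc_add_right_aux[of b' n b a] assms
  by (cases "b' \<le> b") (auto simp: add.commute)

lemma vdc_add_right_above:
  assumes "2 ^ n \<le> b + b'" "b \<le> 2 ^ n" "b' \<le> 2 ^ n"
  shows "vdc n a b + vdc n a b' \<le> a + vdc n a (b + b' - 2 ^ n)"
  using vdc_add_right_aux[of b n b' a] vdc_add_right_aux[of b' n b a] assms
  by (cases "b' \<le> b") (auto simp: add.commute)

lemma halves_add:
  fixes x y :: nat
  obtains "(x + 1) div 2 + (y + 1) div 2 = (x + y + 1) div 2" "x div 2 + y div 2 = (x + y) div 2"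
  | "(x + 1) div 2 + (y + 1) div 2 = Suc ((x + y + 1) div 2)" "(x + y) div 2 = Suc (x div 2 + y div 2)"
proof (cases "even x \<or> even y")
  case True
  then show ?thesis by (intro that(1)) (auto elim!: evenE)
next
  case False
  then obtain i j where "x = 2 * i + 1" "y = 2 * j + 1" by (auto elim!: oddE)
  then show ?thesis by (intro that(2)) auto
qed

text \<open>The inductive step for the intersection bound. Here \<open>(a0, b0)\<close> are the sizes of the
sections without the new element and \<open>(a1, b1)\<close> those of the sections containing it. If \<open>b0\<close> and \<open>b1\<close> lie
in the same half of \<open>{0..2 ^ n}\<close>, both sides unfold in the same way and the induction hypothesis
applies. If \<open>b1 \<le> 2 ^ (n - 1) \<le> b0\<close>, the points counted with \<open>b0\<close> include a full lower half, and the
rest is moved next to the interval \<open>b1\<close> by \<open>vdc_add_right_below\<close> or \<open>vdc_add_right_above\<close>.\<close>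

lemma vdc_merge:
  assumes "a0 \<le> a1" "b1 \<le> b0" "b0 \<le> 2 ^ n"
  shows "vdc n a0 b0 + vdc n a1 b1 \<le> vdc (Suc n) (a0 + a1) (b0 + b1)"
  using assms
proof (induction n arbitrary: a0 a1 b0 b1)
  case 0
  then have "b0 = 0 \<or> b0 = 1" "b1 = 0 \<or> b1 = 1" by auto
  with 0 show ?case by (auto simp: vdc.simps(2))
next
  case (Suc n)
  define h where "h = (2::nat) ^ n"
  have h2: "(2::nat) ^ Suc n = 2 * h" by (simp add: h_def)
  have b0: "b0 \<le> 2 * h" and b1: "b1 \<le> b0" and a01: "a0 \<le> a1"
    using Suc.prems h2 by auto
  define p0 q0 p1 q1 where "p0 = a0 div 2" and "q0 = (a0 + 1) div 2"
    and "p1 = a1 div 2" and "q1 = (a1 + 1) div 2"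
  define p q where "p = (a0 + a1) div 2" and "q = (a0 + a1 + 1) div 2"
  have low0: "vdc (Suc n) a0 b = vdc n p0 b" and low1: "vdc (Suc n) a1 b = vdc n p1 b"
    if "b \<le> h" for b
    using that unfolding h_def p0_def p1_def by (simp_all only: vdc_Suc_low)
  have high0: "vdc (Suc n) a0 b = p0 + vdc n q0 (b - h)"
    and high1: "vdc (Suc n) a1 b = p1 + vdc n q1 (b - h)" if "h \<le> b" for b
    using that unfolding h_def p0_def p1_def q0_def q1_def by (simp_all only: vdc_Suc_high)
  have low: "vdc (Suc (Suc n)) (a0 + a1) b = vdc (Suc n) p b" if "b \<le> 2 * h" for b
    using that unfolding h2[symmetric] p_def by (rule vdc_Suc_low)
  have high: "vdc (Suc (Suc n)) (a0 + a1) b = p + vdc (Suc n) q (b - 2 * h)" if "2 * h \<le> b" for b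
    using that unfolding h2[symmetric] p_def q_def by (rule vdc_Suc_high)
  have IH: "vdc n a b + vdc n a' b' \<le> vdc (Suc n) (a + a') (b + b')"
    if "a \<le> a'" "b' \<le> b" "b \<le> h" for a a' b b'
    using Suc.IH that unfolding h_def by blast
  have pp: "p0 + p1 \<le> p" "p0 \<le> p1" "q0 \<le> q1" "p0 \<le> q0" "p1 \<le> q1"
    using a01 unfolding p0_def p1_def p_def q0_def q1_def by presburger+
  consider "b0 \<le> h" | "h \<le> b1" | "b1 \<le> h" "h \<le> b0" "b0 + b1 \<le> 2 * h"
    | "b1 \<le> h" "h \<le> b0" "2 * h \<le> b0 + b1" by linarith
  then show ?case
  proof cases
    case 1
    have "vdc n p0 b0 + vdc n p1 b1 \<le> vdc (Suc n) (p0 + p1) (b0 + b1)"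
      using pp b1 1 by (intro IH) auto
    also have "\<dots> \<le> vdc (Suc n) p (b0 + b1)" using pp by (intro vdc_mono) auto
    finally show ?thesis using 1 b1 by (simp add: low0 low1 low)
  next
    case 2
    have "vdc n q0 (b0 - h) + vdc n q1 (b1 - h) \<le> vdc (Suc n) (q0 + q1) (b0 - h + (b1 - h))"
      using pp b1 b0 2 by (intro IH) auto
    also have "b0 - h + (b1 - h) = b0 + b1 - 2 * h" using 2 b1 by linarith
    finally have *: "vdc n q0 (b0 - h) + vdc n q1 (b1 - h) \<le> vdc (Suc n) (q0 + q1) (b0 + b1 - 2 * h)" .
    have "p0 + p1 + vdc (Suc n) (q0 + q1) (b0 + b1 - 2 * h) \<le> p + vdc (Suc n) q (b0 + b1 - 2 * h)"
      using vdc_Suc_left_le[of "Suc n" q "b0 + b1 - 2 * h"]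
      unfolding p0_def p1_def p_def q0_def q1_def q_def
      by (cases a0 a1 rule: halves_add) auto
    with * show ?thesis using 2 b1 by (simp add: high0 high1 high)
  next
    case 3
    \<comment> \<open>Usually \<open>q0 \<le> p1\<close>, so that \<open>r = p1\<close>; the only exception is \<open>a0 = a1\<close> odd, where
      \<open>q0 = p1 + 1\<close>. The maximum treats both situations at once.\<close>
    define r where "r = max q0 p1"
    have "p0 + q0 = a0" unfolding p0_def q0_def by presburger
    moreover have "a0 \<le> p" using a01 unfolding p_def by linarith
    ultimately have r: "q0 \<le> r" "p1 \<le> r" "p0 \<le> r" "p0 + r \<le> p"
      using pp(1,4) unfolding r_def by (simp_all add: max_def)
    have "vdc n q0 (b0 - h) + vdc n p1 b1 \<le> vdc n r (b0 - h) + vdc n r b1"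
      using r by (intro add_mono vdc_mono) auto
    also have "\<dots> \<le> vdc n r (b0 - h + b1)"
      using 3 by (intro vdc_add_right_below) (auto simp: h_def)
    finally have "p0 + vdc n q0 (b0 - h) + vdc n p1 b1 \<le> vdc n p0 h + vdc n r (b0 - h + b1)"
      by (simp add: h_def vdc_full)
    also have "\<dots> \<le> vdc (Suc n) (p0 + r) (h + (b0 - h + b1))"
      using r 3 by (intro IH) auto
    also have "\<dots> \<le> vdc (Suc n) p (b0 + b1)"
      using r 3 by (intro vdc_mono) auto
    finally show ?thesis using 3 by (simp add: high0 low1 low)
  next
    case 4
    \<comment> \<open>Now a common size below both \<open>q0\<close> and \<open>p1\<close> is needed, and passing to it costs at most
      the difference in size, by \<open>vdc_lipschitz\<close>.\<close>
    define r where "r = min q0 p1"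
    have r: "r \<le> q0" "r \<le> p1" by (simp_all add: r_def)
    have r2: "r \<le> q div 2" "p0 + p1 + q0 \<le> p + r"
      using a01 unfolding r_def p0_def p1_def p_def q0_def q_def min_def
      by (cases "a0 = a1"; simp; linarith)+
    define u w where "u = b0 - h" and "w = b0 + b1 - 2 * h"
    have w: "u + b1 - h = w" using 4 unfolding u_def w_def by linarith
    have "vdc n q0 u + r \<le> vdc n r u + q0"
      using vdc_lipschitz[of n r "q0 - r" u] r by simp
    moreover have "vdc n p1 b1 + r \<le> vdc n r b1 + p1"
      using vdc_lipschitz[of n r "p1 - r" b1] r by simp
    moreover have "vdc n r u + vdc n r b1 \<le> r + vdc n r w"
      using vdc_add_right_above[of n u b1 r] 4 b0 unfolding w[symmetric] by (auto simp: h_def u_def)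
    moreover have "vdc n r w \<le> vdc n (q div 2) w"
      using r2 by (intro vdc_mono) auto
    moreover have "vdc n (q div 2) w \<le> vdc (Suc n) q w"
      by (rule vdc_half_le)
    ultimately have "p0 + vdc n q0 u + vdc n p1 b1 \<le> p + vdc (Suc n) q w"
      using r2(2) by linarith
    then show ?thesis using 4 by (simp add: high0 low1 high u_def w_def)
  qed
qed

section \<open>The best pair of sizes with a given sum\<close>

text \<open>The maximum of \<open>vdc n a b\<close> over all \<open>a, b \<le> 2 ^ n\<close> with \<open>a + b = s\<close>. The step from \<open>n\<close> to
  \<open>n + 2\<close> comes from one unfolding of \<open>vdc\<close> in each argument: for small sums the best pair lies in the
  lower halves of both ranges, for large sums in the upper halves.\<close>
fun env :: "nat \<Rightarrow> nat \<Rightarrow> nat" where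
  "env 0 s = s - 1"
| "env (Suc 0) s = s - 2"
| "env (Suc (Suc n)) s =
    (if s \<le> 2 ^ (n + 2) then env n (s div 2)
     else 2 ^ n + (s - 2 ^ (n + 2)) div 2 + env n ((s - 2 ^ (n + 2) + 1) div 2))"

lemma env_zero [simp]: "env n 0 = 0"
  by (induction n rule: induct_nat_012) auto

lemma env_top: "env n (2 ^ Suc n) = 2 ^ n"
proof (induction n rule: induct_nat_012)
  case (ge2 n)
  have "(2::nat) ^ Suc (Suc (Suc n)) - 2 ^ (n + 2) = 2 ^ (n + 2)" by simp
  then show ?case using ge2(1) by simp
qed auto

lemma env_low: "s \<le> 2 ^ (n + 2) \<Longrightarrow> env (Suc (Suc n)) s = env n (s div 2)"
  by simp

lemma env_high: "env (Suc (Suc n)) (2 ^ (n + 2) + t) = 2 ^ n + t div 2 + env n ((t + 1) div 2)"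
  using env_top[of n] by (cases "t = 0") simp_all

declare env.simps(3) [simp del]

lemma env_Suc: "env n s \<le> env n (Suc s) \<and> env n (Suc s) \<le> Suc (env n s)"
proof (induction n arbitrary: s rule: induct_nat_012)
  case (ge2 n)
  show ?case
  proof (cases "Suc s \<le> 2 ^ (n + 2)")
    case True
    have "Suc s div 2 = s div 2 \<or> Suc s div 2 = Suc (s div 2)" by presburger
    with True show ?thesis using ge2(1)[of "s div 2"] by (auto simp: env_low)
  next
    case False
    define t where "t = s - 2 ^ (n + 2)"
    have s: "s = 2 ^ (n + 2) + t" "Suc s = 2 ^ (n + 2) + Suc t"
      using False by (simp_all add: t_def)
    have "Suc t div 2 = t div 2 \<and> (Suc t + 1) div 2 = Suc ((t + 1) div 2) \<or>
       Suc t div 2 = Suc (t div 2) \<and> (Suc t + 1) div 2 = (t + 1) div 2" by presburger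
    then show ?thesis
      using ge2(1)[of "(t + 1) div 2"] unfolding s(2) unfolding s(1) env_high
      by (elim disjE conjE; simp only:; intro conjI; linarith)
  qed
qed auto

lemma env_mono: "s \<le> t \<Longrightarrow> env n s \<le> env n t"
  by (rule lift_Suc_mono_le[of "env n"]) (use env_Suc in auto)

lemma env_lipschitz: "env n (s + t) \<le> env n s + t"
proof (induction t)
  case (Suc t)
  then show ?case using env_Suc[of n "s + t"] by simp
qed auto

text \<open>Unfold \<open>vdc\<close> once in each argument. If \<open>a\<close> and \<open>b\<close> lie in the same half of the range, the recursion
of \<open>env\<close> has the same form, up to rounding that \<open>env_Suc\<close> absorbs. If they lie in different halves,
the value is at most \<open>(a + b - 2 ^ (n + 1)) div 2\<close>, which is the value of \<open>vdc (n + 2)\<close> at the more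
balanced pair of sizes with one entry equal to \<open>2 ^ (n + 1)\<close>.\<close>

lemma vdc_le_env: "a \<le> 2 ^ n \<Longrightarrow> b \<le> 2 ^ n \<Longrightarrow> vdc n a b \<le> env n (a + b)"
proof (induction n arbitrary: a b rule: induct_nat_012)
  case 0
  then have "a = 0 \<or> a = 1" "b = 0 \<or> b = 1" by auto
  then show ?case by auto
next
  case 1
  then have "a = 0 \<or> a = 1 \<or> a = 2" "b = 0 \<or> b = 1 \<or> b = 2" by auto
  then show ?case by (auto simp: vdc.simps(2))
next
  case (ge2 n)
  define h where "h = (2::nat) ^ n"
  have pow: "(2::nat) ^ Suc n = 2 * h" "(2::nat) ^ (n + 2) = 4 * h" by (simp_all add: h_def)
  have ab: "a \<le> 4 * h" "b \<le> 4 * h" using ge2.prems pow by auto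
  have IH: "vdc n a b \<le> env n (a + b)" if "a \<le> h" "b \<le> h" for a b
    using ge2.IH(1) that unfolding h_def by blast
  have rlow: "vdc (Suc (Suc n)) a b = vdc (Suc n) (a div 2) b" if "b \<le> 2 * h" for a b
    using vdc_Suc_low[of b "Suc n" a] that unfolding pow by simp
  have rhigh: "vdc (Suc (Suc n)) a b = a div 2 + vdc (Suc n) ((a + 1) div 2) (b - 2 * h)"
    if "2 * h \<le> b" for a b
    using vdc_Suc_high[of "Suc n" b a] that unfolding pow by simp
  have llow: "vdc (Suc n) a b = vdc n a (b div 2)" if "a \<le> h" for a b
    using vdc_Suc_left_low[of a n b] that unfolding h_def by simp
  have lhigh: "vdc (Suc n) a b = b div 2 + vdc n (a - h) ((b + 1) div 2)"
    if "h \<le> a" "a \<le> 2 * h" "b \<le> 2 * h" for a b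
    using vdc_Suc_left_high[of "a - h" n b] that unfolding h_def by simp
  have env_low: "env (Suc (Suc n)) s = env n (s div 2)" if "s \<le> 4 * h" for s
    using that pow by (simp add: env_low)
  have env_high: "env (Suc (Suc n)) s = h + (s - 4 * h) div 2 + env n ((s - 4 * h + 1) div 2)"
    if "4 * h \<le> s" for s
    using env_high[of n "s - 4 * h"] that unfolding pow(2) h_def[symmetric] by simp
  have mixed: "v \<le> env (Suc (Suc n)) (a + b)"
    if v: "v \<le> (a + b - 2 * h) div 2" and s: "2 * h \<le> a + b" for v
  proof (cases "a + b \<le> 4 * h")
    case True
    have "v \<le> vdc n ((a + b - 2 * h) div 2) h"
      using v by (simp add: h_def vdc_full)
    also have "\<dots> \<le> env n ((a + b - 2 * h) div 2 + h)"
      using True by (intro IH) auto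
    also have "(a + b - 2 * h) div 2 + h = (a + b) div 2" using s by linarith
    finally show ?thesis using env_low[OF True] by simp
  next
    case False
    then have "(a + b - 2 * h) div 2 = h + (a + b - 4 * h) div 2" by linarith
    with v False show ?thesis by (simp add: env_high)
  qed
  consider "a \<le> 2 * h" "b \<le> 2 * h" | "a \<le> 2 * h" "2 * h \<le> b"
    | "2 * h \<le> a" "b \<le> 2 * h" | "2 * h \<le> a" "2 * h \<le> b" by linarith
  then show ?case
  proof cases
    case 1
    have "vdc (Suc (Suc n)) a b = vdc n (a div 2) (b div 2)"
      using 1 by (simp add: rlow llow)
    also have "\<dots> \<le> env n (a div 2 + b div 2)" using 1 by (intro IH) auto
    also have "\<dots> \<le> env n ((a + b) div 2)" by (intro env_mono) linarith
    finally show ?thesis using 1 env_low[of "a + b"] by linarith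
  next
    case 2
    have "vdc (Suc (Suc n)) a b = a div 2 + vdc n ((a + 1) div 2) ((b - 2 * h) div 2)"
      using 2 by (simp add: rhigh llow)
    also have "\<dots> \<le> a div 2 + (b - 2 * h) div 2"
      using 2 by (intro add_left_mono vdc_le_right) (auto simp: h_def)
    also have "\<dots> \<le> (a + b - 2 * h) div 2" using 2 by linarith
    finally show ?thesis using 2 by (intro mixed) auto
  next
    case 3
    have "vdc (Suc (Suc n)) a b = b div 2 + vdc n (a div 2 - h) ((b + 1) div 2)"
      using 3 ab by (simp add: rlow lhigh)
    also have "\<dots> \<le> b div 2 + (a div 2 - h)"
      by (intro add_left_mono vdc_le_left)
    also have "\<dots> \<le> (a + b - 2 * h) div 2" using 3 by linarith
    finally show ?thesis using 3 by (intro mixed) auto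
  next
    case 4
    define \<alpha> \<beta> where "\<alpha> = a - 2 * h" and "\<beta> = b - 2 * h"
    have a: "a = 2 * h + \<alpha>" "b = 2 * h + \<beta>" "\<alpha> \<le> 2 * h" "\<beta> \<le> 2 * h"
      using 4 ab unfolding \<alpha>_def \<beta>_def by auto
    have "vdc (Suc (Suc n)) a b = a div 2 + vdc (Suc n) ((a + 1) div 2) \<beta>"
      using 4 by (simp add: rhigh \<beta>_def)
    also have "vdc (Suc n) ((a + 1) div 2) \<beta> = \<beta> div 2 + vdc n ((a + 1) div 2 - h) ((\<beta> + 1) div 2)"
      using a by (intro lhigh) auto
    also have "(a + 1) div 2 - h = (\<alpha> + 1) div 2" using a by linarith
    also have "a div 2 = h + \<alpha> div 2" using a by linarith
    also have "vdc n ((\<alpha> + 1) div 2) ((\<beta> + 1) div 2) \<le> env n ((\<alpha> + 1) div 2 + (\<beta> + 1) div 2)"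
      using a by (intro IH) auto
    finally have le: "vdc (Suc (Suc n)) a b
        \<le> h + \<alpha> div 2 + (\<beta> div 2 + env n ((\<alpha> + 1) div 2 + (\<beta> + 1) div 2))" by simp
    have le2: "\<alpha> div 2 + \<beta> div 2 + env n ((\<alpha> + 1) div 2 + (\<beta> + 1) div 2)
        \<le> (\<alpha> + \<beta>) div 2 + env n ((\<alpha> + \<beta> + 1) div 2)"
      using env_Suc[of n "(\<alpha> + \<beta> + 1) div 2"] by (cases \<alpha> \<beta> rule: halves_add) auto
    have s: "a + b = 4 * h + (\<alpha> + \<beta>)" using a by simp
    have "env (Suc (Suc n)) (a + b) = h + (\<alpha> + \<beta>) div 2 + env n ((\<alpha> + \<beta> + 1) div 2)"
      using s by (simp add: env_high)
    then show ?thesis using le le2 by linarith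
  qed
qed

text \<open>On the block of sums from \<open>(\<kappa> * c + d) * 2 ^ k\<close> to \<open>(\<kappa> * c + d + 1) * 2 ^ k\<close> the pair
\<open>a = \<kappa> * c * 2 ^ k\<close> and \<open>b = d * 2 ^ k + r\<close> is optimal. The two inequalities between \<open>c\<close> and \<open>d\<close>
determine \<open>c\<close> from the index \<open>\<kappa> * c + d\<close> of the block by keeping \<open>d\<close> close to \<open>\<kappa> * c\<close>. Both ends of
the block are included (\<open>r \<le> 2 ^ k\<close>), since halving with rounding up in the recursion may reach the
right end.\<close>

lemma env_block:
  fixes e k c d r :: nat
  defines "\<kappa> \<equiv> (2::nat) ^ e"
  assumes "e \<le> 1" "\<kappa> * c \<le> d + \<kappa>" "d < \<kappa> * c + \<kappa>" "r \<le> 2 ^ k"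
    and "(\<kappa> * c + d) * 2 ^ k + r \<le> 2 ^ Suc (2 * k + e)"
  shows "env (2 * k + e) ((\<kappa> * c + d) * 2 ^ k + r) = c * d + vdc k c r"
  using assms(3-)
proof (induction k arbitrary: c d r)
  case 0
  from \<open>e \<le> 1\<close> consider "e = 0" | "e = 1" by linarith
  then show ?case
  proof cases
    case 1
    then have "c + d + r \<le> 2" "c \<le> d + 1" "d \<le> c" "r \<le> 1" using 0 unfolding \<kappa>_def by auto
    then have "c = 0 \<and> d = 0 \<or> c = 1" "r = 0 \<or> r = 1" by linarith+
    with 1 show ?thesis by (auto simp: \<kappa>_def)
  next
    case 2
    then have "2 * c + d + r \<le> 4" "2 * c \<le> d + 2" "d \<le> 2 * c + 1" "r \<le> 1"
      using 0 unfolding \<kappa>_def by auto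
    then have "c = 0 \<and> d \<le> 1 \<or> c = 1" "r = 0 \<or> r = 1" by linarith+
    with 2 show ?thesis by (auto simp: \<kappa>_def)
  qed
next
  case (Suc k)
  define K where "K = (2::nat) ^ k"
  define n where "n = 2 * k + e"
  have \<kappa>: "\<kappa> = 1 \<or> \<kappa> = 2" using \<open>e \<le> 1\<close> by (cases e) (auto simp: \<kappa>_def)
  have \<kappa>0: "0 < \<kappa>" by (simp add: \<kappa>_def)
  have K0: "0 < K" by (simp add: K_def)
  have pow_k: "(2::nat) ^ Suc k = 2 * K" by (simp add: K_def)
  have pow_n: "(2::nat) ^ n = \<kappa> * K * K"
    by (simp add: K_def \<kappa>_def n_def power_add mult_2)
  have pow_n2: "(2::nat) ^ (n + 2) = 4 * \<kappa> * K * K" by (simp add: pow_n power_add)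
  have n: "2 * Suc k + e = Suc (Suc n)" by (simp add: n_def)
  have pow_n3: "(2::nat) ^ Suc (2 * Suc k + e) = 8 * \<kappa> * K * K" unfolding n by (simp add: pow_n)
  define s where "s = (\<kappa> * c + d) * (2 * K) + r"
  have bound: "s \<le> 8 * \<kappa> * K * K" and r: "r \<le> 2 * K"
    and cd: "\<kappa> * c \<le> d + \<kappa>" "d < \<kappa> * c + \<kappa>"
    using Suc.prems unfolding pow_n3 pow_k s_def by simp_all
  have IH: "env n ((\<kappa> * c + d) * K + r) = c * d + vdc k c r"
    if "\<kappa> * c \<le> d + \<kappa>" "d < \<kappa> * c + \<kappa>" "r \<le> K" "(\<kappa> * c + d) * K + r \<le> 2 * \<kappa> * K * K" for c d r
    using Suc.IH[of c d r] that unfolding n_def[symmetric] K_def[symmetric]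
    by (simp add: pow_n ac_simps)
  have "env (Suc (Suc n)) s = c * d + vdc (Suc k) c r"
  proof (cases "s \<le> 4 * \<kappa> * K * K")
    case True
    have "2 * K * (\<kappa> * c + d) \<le> 2 * K * (2 * \<kappa> * K)"
      using True by (simp add: s_def algebra_simps)
    then have "\<kappa> * c + d \<le> 2 * \<kappa> * K" using K0 by simp
    then have "2 * (\<kappa> * c) < 2 * (\<kappa> * (K + 1))" using cd \<kappa>0 by (simp add: algebra_simps)
    then have "c < K + 1" by (simp only: mult_less_cancel1)
    then have c: "c \<le> K" by simp
    have half: "s div 2 = (\<kappa> * c + d) * K + r div 2"
      by (simp add: s_def)
    have "env (Suc (Suc n)) s = env n (s div 2)"
      using True by (intro env_low) (simp only: pow_n2)
    also have "\<dots> = c * d + vdc k c (r div 2)"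
      unfolding half using True half cd r by (intro IH) auto
    also have "vdc k c (r div 2) = vdc (Suc k) c r"
      using c by (intro vdc_Suc_left_low[symmetric]) (simp add: K_def)
    finally show ?thesis .
  next
    case False
    have "2 * K * (2 * \<kappa> * K) < 2 * K * (\<kappa> * c + d + 1)"
      using False r by (simp add: s_def algebra_simps)
    then have "2 * \<kappa> * K < \<kappa> * c + d + 1" by (simp only: mult_less_cancel1)
    then have q: "2 * \<kappa> * K \<le> \<kappa> * c + d" by simp
    have d: "\<kappa> * K \<le> d"
    proof (rule ccontr)
      assume "\<not> \<kappa> * K \<le> d"
      then have "\<kappa> * c < \<kappa> * (K + 1)" using cd by simp
      then have "c < K + 1" by (simp only: mult_less_cancel1)
      then have "\<kappa> * c \<le> \<kappa> * K" by simp
      with q \<open>\<not> \<kappa> * K \<le> d\<close> show False by simp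
    qed
    have c: "K \<le> c"
    proof (rule ccontr)
      assume "\<not> K \<le> c"
      then have "\<kappa> * (c + 1) \<le> \<kappa> * K" by (intro mult_le_mono) auto
      then show False using cd q by simp
    qed
    have "2 * K * (\<kappa> * c + d) \<le> 2 * K * (4 * \<kappa> * K)"
      using bound by (simp add: s_def algebra_simps)
    then have "\<kappa> * c + d \<le> 4 * \<kappa> * K" using K0 by simp
    then have "2 * (\<kappa> * c) < 2 * (\<kappa> * (2 * K + 1))" using cd \<kappa>0 by (simp add: algebra_simps)
    then have "c < 2 * K + 1" by (simp only: mult_less_cancel1)
    then have c2: "c \<le> 2 * K" by simp
    \<comment> \<open>Subtracting \<open>4 * \<kappa> * K * K\<close> from the sum amounts to translating \<open>(c, d)\<close> by
      \<open>(K, \<kappa> * K)\<close>.\<close>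
    obtain c' d' where c': "c = K + c'" and d': "d = \<kappa> * K + d'"
      using c d le_Suc_ex by blast
    define t where "t = (\<kappa> * c' + d') * (2 * K) + r"
    have s_t: "s = 2 ^ (n + 2) + t"
      unfolding s_def t_def pow_n2 c' d' by (simp add: algebra_simps)
    have halves: "t div 2 = (\<kappa> * c' + d') * K + r div 2"
      "(t + 1) div 2 = (\<kappa> * c' + d') * K + (r + 1) div 2"
      by (simp_all add: t_def)
    have t: "t \<le> 4 * \<kappa> * K * K" using bound unfolding s_t pow_n2 by (simp add: algebra_simps)
    have "env n ((t + 1) div 2) = c' * d' + vdc k c' ((r + 1) div 2)"
      unfolding halves using cd r t halves(2)
      by (intro IH) (auto simp: c' d' algebra_simps)
    moreover have "vdc (Suc k) c r = r div 2 + vdc k c' ((r + 1) div 2)"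
      unfolding c' K_def using c2 r by (intro vdc_Suc_left_high) (simp_all add: c' K_def)
    ultimately show ?thesis
      unfolding s_t env_high halves(1) by (simp add: pow_n c' d' algebra_simps)
  qed
  then show ?case unfolding n s_def pow_k .
qed

section \<open>The function delta as a threshold\<close>

lemma delta_1: "delta 1 x = of_nat x"
  by (subst delta.simps) simp

lemma delta_low: "2 \<le> k \<Longrightarrow> x < k div 2 \<Longrightarrow> delta k x = delta (k div 2) x / 2"
  by (subst delta.simps) simp

lemma delta_high:
  "2 \<le> k \<Longrightarrow> k div 2 \<le> x \<Longrightarrow> delta k x = 1 / 2 + delta ((k + 1) div 2) (x - k div 2) / 2"
  by (subst delta.simps) simp

lemma delta_double:
  assumes "0 < c"
  shows "delta (2 * c) x = (if x < c then delta c x / 2 else 1 / 2 + delta c (x - c) / 2)"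
  using assms delta_low[of "2 * c" x] delta_high[of "2 * c" x] by auto

text \<open>Halving an even multiple of \<open>c\<close> involves no rounding, so the first one or two steps of the recursion
cut \<open>{0..2 * 2 ^ e * c}\<close> into \<open>2 * 2 ^ e\<close> equal pieces of length \<open>c\<close>, each of which carries a scaled copy of
\<open>delta c\<close>.\<close>

lemma delta_multiple:
  assumes "e \<le> 1" "0 < c" "j < 2 * 2 ^ e" "x < c"
  shows "2 * 2 ^ e * delta (2 * 2 ^ e * c) (j * c + x) = of_nat j + delta c x"
proof -
  have two: "2 * delta (2 * c) (i * c + x) = of_nat i + delta c x" if "i < 2" for i
  proof -
    from that have "i = 0 \<or> i = 1" by auto
    then show ?thesis using assms by (auto simp: delta_double)
  qed
  from assms(1) consider "e = 0" | "e = 1" by linarith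
  then show ?thesis
  proof cases
    case 1
    then show ?thesis using two[of j] assms by simp
  next
    case 2
    show ?thesis
    proof (cases "j < 2")
      case True
      have "j * c + x < 2 * c"
        using True assms by (cases j) auto
      then have "2 * delta (2 * (2 * c)) (j * c + x) = delta (2 * c) (j * c + x)"
        using assms by (subst delta_double) auto
      with two[OF True] 2 show ?thesis by (simp add: mult.assoc)
    next
      case False
      then obtain i where i: "j = 2 + i" using le_Suc_ex not_less by blast
      have "2 * delta (2 * (2 * c)) (j * c + x) = 1 + delta (2 * c) (i * c + x)"
        using assms by (subst delta_double) (auto simp: i algebra_simps)
      with two[of i] 2 i assms show ?thesis by (simp add: mult.assoc)
    qed
  qed
qed

text \<open>An up-set of size \<open>c\<close> has sections of sizes \<open>c div 2\<close> and \<open>(c + 1) div 2\<close> in the extremal example. A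
down-set with fewer than \<open>2 ^ k\<close> members reaches only the first of them, and cannot cover it
(\<open>vdc_less_left\<close>). Hence the least size needed to meet \<open>x\<close> sets is found by deciding whether
\<open>x < c div 2\<close> and continuing in the corresponding half, which is the recursion of \<open>delta\<close>.\<close>

lemma delta_vdc_galois:
  assumes "0 < c" "c \<le> 2 ^ k" "x \<le> c"
  shows "\<exists>r\<le>2 ^ k. of_nat r = 2 ^ k * delta c x \<and> (\<forall>b. x \<le> vdc k c b \<longleftrightarrow> r \<le> b)"
  using assms
proof (induction k arbitrary: c x)
  case 0
  then have "c = 1" "x = 0 \<or> x = 1" by auto
  then show ?case using delta_1[of x] by (intro exI[of _ x]) auto
next
  case (Suc k)
  show ?case
  proof (cases "x < c div 2 \<or> x = 0")
    case True
    show ?thesis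
    proof (cases "c = 1")
      case True
      with \<open>x < c div 2 \<or> x = 0\<close> have "x = 0" by auto
      with True show ?thesis using delta_1[of 0] by (intro exI[of _ 0]) simp
    next
      case False
      have c: "2 \<le> c" "x < c div 2" using False True Suc.prems by auto
      have c': "0 < c div 2" "c div 2 \<le> 2 ^ k" "x \<le> c div 2" using c Suc.prems by auto
      obtain r where r: "r \<le> 2 ^ k" "of_nat r = 2 ^ k * delta (c div 2) x"
        "\<And>b. x \<le> vdc k (c div 2) b \<longleftrightarrow> r \<le> b"
        using Suc.IH[OF c'] by auto
      have "x \<le> vdc (Suc k) c b \<longleftrightarrow> r \<le> b" for b
      proof (cases "b \<le> 2 ^ k")
        case True
        then show ?thesis using r(3) by (simp add: vdc_Suc_low)
      next
        case False
        then show ?thesis using c r(1) by (simp add: vdc_Suc_high)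
      qed
      moreover have "of_nat r = 2 ^ Suc k * delta c x"
        using c r(2) by (simp add: delta_low)
      ultimately show ?thesis using r(1) by (intro exI[of _ r]) auto
    qed
  next
    case False
    define y where "y = x - c div 2"
    have y: "x = c div 2 + y" "y \<le> (c + 1) div 2" using False Suc.prems by (auto simp: y_def)
    have c: "0 < (c + 1) div 2" "(c + 1) div 2 \<le> 2 ^ k" using Suc.prems by auto
    obtain r where r: "r \<le> 2 ^ k" "of_nat r = 2 ^ k * delta ((c + 1) div 2) y"
      "\<And>b. y \<le> vdc k ((c + 1) div 2) b \<longleftrightarrow> r \<le> b"
      using Suc.IH[OF c y(2)] by auto
    have "x \<le> vdc (Suc k) c b \<longleftrightarrow> 2 ^ k + r \<le> b" for b
    proof (cases "2 ^ k \<le> b")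
      case True
      then show ?thesis using r(3)[of "b - 2 ^ k"] by (auto simp: vdc_Suc_high y(1))
    next
      case b: False
      \<comment> \<open>Below \<open>2 ^ k\<close> even the value \<open>c div 2\<close> is out of reach.\<close>
      have "vdc k (c div 2) b < x"
      proof (cases "c div 2 = 0")
        case True
        then show ?thesis using False by simp
      next
        case False
        then show ?thesis using vdc_less_left[of "c div 2" b k] b y(1) by simp
      qed
      with b show ?thesis by (simp add: vdc_Suc_low)
    qed
    moreover have "of_nat (2 ^ k + r) = 2 ^ Suc k * delta c x"
    proof (cases "c = 1")
      case True
      with False Suc.prems have "x = 1" by auto
      with True y r(2) show ?thesis using delta_1[of 1] by simp
    next
      case False
      then have "delta c x = 1 / 2 + delta ((c + 1) div 2) y / 2"
        unfolding y_def using Suc.prems y(1) by (intro delta_high) auto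
      then show ?thesis using r(2) by (simp add: algebra_simps)
    qed
    ultimately show ?thesis using r(1) by (intro exI[of _ "2 ^ k + r"]) auto
  qed
qed

text \<open>For \<open>r = 0\<close> this is the product situation: the up-set is determined by \<open>c\<close> sets on the first \<open>k\<close>
elements and the down-set by \<open>d\<close> sets on the other \<open>l\<close> elements. The \<open>r\<close> further members of the
down-set lie in one more fibre, a cube of dimension \<open>k\<close>.\<close>

lemma vdc_product:
  assumes "d * 2 ^ k + r \<le> 2 ^ (k + l)" "r \<le> 2 ^ k"
  shows "vdc (k + l) (c * 2 ^ l) (d * 2 ^ k + r) = c * d + vdc k c r"
  using assms
proof (induction l arbitrary: d)
  case 0
  then have "d = 0 \<or> d = 1 \<and> r = 0" by (cases d) auto
  then show ?case using vdc_full[of k "2 ^ k" c] by auto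
next
  case (Suc l)
  have half: "c * 2 ^ Suc l div 2 = c * 2 ^ l" "(c * 2 ^ Suc l + 1) div 2 = c * 2 ^ l" by simp_all
  show ?case
  proof (cases "d * 2 ^ k + r \<le> 2 ^ (k + l)")
    case True
    then show ?thesis using Suc.IH[OF True Suc.prems(2)] by (simp add: vdc_Suc_low half del: power_Suc)
  next
    case False
    have "2 ^ k * 2 ^ l < 2 ^ k * (d + 1)"
      using False Suc.prems(2) by (simp add: power_add algebra_simps)
    then have "2 ^ l < d + 1" by (simp only: mult_less_cancel1)
    then have "2 ^ l \<le> d" by simp
    then obtain i where d: "d = 2 ^ l + i" using le_Suc_ex by blast
    have eq: "d * 2 ^ k + r = 2 ^ (k + l) + (i * 2 ^ k + r)"
      by (simp add: d power_add algebra_simps)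
    have "i * 2 ^ k + r \<le> 2 ^ (k + l)" using Suc.prems(1) unfolding eq by simp
    from Suc.IH[OF this Suc.prems(2)] show ?thesis
      unfolding eq by (simp add: vdc_Suc_high half d algebra_simps del: power_Suc)
  qed
qed

section \<open>Up-sets and down-sets in the cube\<close>

definition up_set :: "nat \<Rightarrow> nat set set \<Rightarrow> bool" where
  "up_set n U \<longleftrightarrow> U \<subseteq> Pow {1..n} \<and> (\<forall>S\<in>U. \<forall>T. S \<subseteq> T \<and> T \<subseteq> {1..n} \<longrightarrow> T \<in> U)"

definition down_set :: "nat \<Rightarrow> nat set set \<Rightarrow> bool" where
  "down_set n D \<longleftrightarrow> D \<subseteq> Pow {1..n} \<and> (\<forall>S\<in>D. \<forall>T. T \<subseteq> S \<longrightarrow> T \<in> D)"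

lemma up_setI:
  assumes "U \<subseteq> Pow {1..n}"
    and "\<And>S T. S \<in> U \<Longrightarrow> S \<subseteq> T \<Longrightarrow> T \<subseteq> {1..n} \<Longrightarrow> T \<in> U"
  shows "up_set n U"
  unfolding up_set_def using assms by (intro conjI ballI allI impI) auto

lemma up_setD: "up_set n U \<Longrightarrow> S \<in> U \<Longrightarrow> S \<subseteq> T \<Longrightarrow> T \<subseteq> {1..n} \<Longrightarrow> T \<in> U"
  unfolding up_set_def by simp

lemma up_set_subset: "up_set n U \<Longrightarrow> U \<subseteq> Pow {1..n}"
  unfolding up_set_def by simp

lemma down_setI:
  assumes "D \<subseteq> Pow {1..n}" and "\<And>S T. S \<in> D \<Longrightarrow> T \<subseteq> S \<Longrightarrow> T \<in> D"
  shows "down_set n D"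
  unfolding down_set_def using assms by (intro conjI ballI allI impI) auto

lemma down_setD: "down_set n D \<Longrightarrow> S \<in> D \<Longrightarrow> T \<subseteq> S \<Longrightarrow> T \<in> D"
  unfolding down_set_def by simp

lemma down_set_subset: "down_set n D \<Longrightarrow> D \<subseteq> Pow {1..n}"
  unfolding down_set_def by simp

lemma finite_subset_Pow: "A \<subseteq> Pow {1..n::nat} \<Longrightarrow> finite A"
  by (rule finite_subset) auto

text \<open>The family whose sections without and with the new element \<open>Suc n\<close> are \<open>A\<close> and \<open>B\<close>.\<close>

definition glue :: "nat \<Rightarrow> nat set set \<Rightarrow> nat set set \<Rightarrow> nat set set" where
  "glue n A B = A \<union> insert (Suc n) ` B"

lemma mem_glue:
  assumes "A \<subseteq> Pow {1..n}" "B \<subseteq> Pow {1..n}"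
  shows "S \<in> glue n A B \<longleftrightarrow> (if Suc n \<in> S then S - {Suc n} \<in> B else S \<in> A)"
proof -
  have notin: "Suc n \<notin> T" if "T \<in> A \<or> T \<in> B" for T
    using that assms by fastforce
  show ?thesis
  proof (cases "Suc n \<in> S")
    case True
    have "S \<in> insert (Suc n) ` B \<longleftrightarrow> S - {Suc n} \<in> B"
    proof
      assume "S \<in> insert (Suc n) ` B"
      then obtain T where "T \<in> B" "S = insert (Suc n) T" by auto
      with notin show "S - {Suc n} \<in> B" by auto
    next
      assume "S - {Suc n} \<in> B"
      then show "S \<in> insert (Suc n) ` B" using True by (intro image_eqI[of _ _ "S - {Suc n}"]) auto
    qed
    with True notin show ?thesis by (auto simp: glue_def)
  next
    case False
    then show ?thesis by (auto simp: glue_def)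
  qed
qed

lemma glue_subset:
  assumes "A \<subseteq> Pow {1..n}" "B \<subseteq> Pow {1..n}"
  shows "glue n A B \<subseteq> Pow {1..Suc n}"
  using assms unfolding glue_def by fastforce

lemma card_glue:
  assumes "A \<subseteq> Pow {1..n}" "B \<subseteq> Pow {1..n}"
  shows "card (glue n A B) = card A + card B"
proof -
  have notin: "Suc n \<notin> T" if "T \<in> A \<or> T \<in> B" for T
    using that assms by fastforce
  have "finite A" "finite B" by (fact finite_subset_Pow[OF assms(1)] finite_subset_Pow[OF assms(2)])+
  moreover have "A \<inter> insert (Suc n) ` B = {}" using notin by blast
  moreover have "inj_on (insert (Suc n)) B"
    by (rule inj_onI) (metis Diff_insert_absorb notin)
  ultimately show ?thesis unfolding glue_def by (simp add: card_Un_disjoint card_image)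
qed

lemma glue_Int:
  assumes "A \<subseteq> Pow {1..n}" "B \<subseteq> Pow {1..n}" "A' \<subseteq> Pow {1..n}" "B' \<subseteq> Pow {1..n}"
  shows "glue n A B \<inter> glue n A' B' = glue n (A \<inter> A') (B \<inter> B')"
proof (rule set_eqI)
  fix S
  have "A \<inter> A' \<subseteq> Pow {1..n}" "B \<inter> B' \<subseteq> Pow {1..n}" using assms by auto
  then show "S \<in> glue n A B \<inter> glue n A' B' \<longleftrightarrow> S \<in> glue n (A \<inter> A') (B \<inter> B')"
    using assms by (auto simp: mem_glue split: if_splits)
qed

lemma glue_mono: "A \<subseteq> A' \<Longrightarrow> B \<subseteq> B' \<Longrightarrow> glue n A B \<subseteq> glue n A' B'"
  unfolding glue_def by auto

lemma up_set_glue: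
  assumes "up_set n A" "up_set n B" "A \<subseteq> B"
  shows "up_set (Suc n) (glue n A B)"
proof (rule up_setI)
  note sub = up_set_subset[OF assms(1)] up_set_subset[OF assms(2)]
  note mem = mem_glue[OF sub]
  show "glue n A B \<subseteq> Pow {1..Suc n}" by (rule glue_subset[OF sub])
  fix S T
  assume S: "S \<in> glue n A B" and ST: "S \<subseteq> T" and T: "T \<subseteq> {1..Suc n}"
  have T': "T - {Suc n} \<subseteq> {1..n}" using T by (auto simp: le_Suc_eq)
  show "T \<in> glue n A B"
  proof (cases "Suc n \<in> T")
    case True
    have SB: "S - {Suc n} \<in> B"
      using S assms(3) unfolding mem by (cases "Suc n \<in> S") auto
    have "T - {Suc n} \<in> B" by (rule up_setD[OF assms(2) SB]) (use ST T' in auto)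
    with True show ?thesis unfolding mem by simp
  next
    case False
    then have "Suc n \<notin> S" using ST by auto
    then have SA: "S \<in> A" using S unfolding mem by simp
    have "T \<in> A" by (rule up_setD[OF assms(1) SA]) (use ST T' False in auto)
    with False show ?thesis unfolding mem by simp
  qed
qed

lemma down_set_glue:
  assumes "down_set n A" "down_set n B" "B \<subseteq> A"
  shows "down_set (Suc n) (glue n A B)"
proof (rule down_setI)
  note sub = down_set_subset[OF assms(1)] down_set_subset[OF assms(2)]
  note mem = mem_glue[OF sub]
  show "glue n A B \<subseteq> Pow {1..Suc n}" by (rule glue_subset[OF sub])
  fix S T
  assume S: "S \<in> glue n A B" and TS: "T \<subseteq> S"
  show "T \<in> glue n A B"
  proof (cases "Suc n \<in> T")
    case True
    then have "Suc n \<in> S" using TS by auto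
    then have SB: "S - {Suc n} \<in> B" using S unfolding mem by simp
    have "T - {Suc n} \<in> B" by (rule down_setD[OF assms(2) SB]) (use TS in auto)
    with True show ?thesis unfolding mem by simp
  next
    case False
    have SA: "S - {Suc n} \<in> A"
      using S assms(3) unfolding mem by (cases "Suc n \<in> S") auto
    have "T \<in> A" by (rule down_setD[OF assms(1) SA]) (use TS False in auto)
    with False show ?thesis unfolding mem by simp
  qed
qed

lemma subset_Pow_Suc_eq_glue:
  assumes "A \<subseteq> Pow {1..Suc n}"
  shows "A = glue n (A \<inter> Pow {1..n}) {S \<in> Pow {1..n}. insert (Suc n) S \<in> A}"
proof (rule set_eqI)
  fix S
  have ins: "insert (Suc n) (S - {Suc n}) = S" if "Suc n \<in> S" using that by auto
  have "S - {Suc n} \<subseteq> {1..n}" if "S \<in> A" using that assms by (force simp: le_Suc_eq)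
  moreover have "S - {Suc n} = S" if "Suc n \<notin> S" using that by auto
  ultimately show "S \<in> A \<longleftrightarrow> S \<in> glue n (A \<inter> Pow {1..n}) {S \<in> Pow {1..n}. insert (Suc n) S \<in> A}"
    using ins by (subst mem_glue) auto
qed

lemma card_le_pow: "A \<subseteq> Pow {1..n} \<Longrightarrow> card A \<le> 2 ^ n"
  using card_mono[of "Pow {1..n}" A] by (simp add: card_Pow)

text \<open>A sharp form of Kleitman's correlation inequality. The section of \<open>U\<close> by the last element contains the
other section of \<open>U\<close>, while for \<open>D\<close> the inclusion is reversed; this is the ordering that \<open>vdc_merge\<close>
requires.\<close>

lemma card_up_set_Int_down_set_le:
  assumes "up_set n U" "down_set n D"
  shows "card (U \<inter> D) \<le> vdc n (card U) (card D)"
  using assms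
proof (induction n arbitrary: U D)
  case 0
  then have "U \<subseteq> {{}}" "D \<subseteq> {{}}" by (auto simp: up_set_def down_set_def)
  then have "U = {} \<or> U = {{}}" "D = {} \<or> D = {{}}" by auto
  then show ?case by auto
next
  case (Suc n)
  define U0 U1 where "U0 = U \<inter> Pow {1..n}" and "U1 = {S \<in> Pow {1..n}. insert (Suc n) S \<in> U}"
  define D0 D1 where "D0 = D \<inter> Pow {1..n}" and "D1 = {S \<in> Pow {1..n}. insert (Suc n) S \<in> D}"
  note U_up = up_setD[OF Suc.prems(1)] and D_down = down_setD[OF Suc.prems(2)]
  have incr: "{1..n} \<subseteq> {1..Suc n}" "Suc n \<in> {1..Suc n}" by auto
  have sub: "U0 \<subseteq> Pow {1..n}" "U1 \<subseteq> Pow {1..n}" "D0 \<subseteq> Pow {1..n}" "D1 \<subseteq> Pow {1..n}"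
    by (auto simp: U0_def U1_def D0_def D1_def)
  have U: "U = glue n U0 U1"
    unfolding U0_def U1_def by (rule subset_Pow_Suc_eq_glue[OF up_set_subset[OF Suc.prems(1)]])
  have D: "D = glue n D0 D1"
    unfolding D0_def D1_def by (rule subset_Pow_Suc_eq_glue[OF down_set_subset[OF Suc.prems(2)]])
  have up: "up_set n U0" "up_set n U1"
  proof -
    show "up_set n U0"
    proof (rule up_setI[OF sub(1)])
      fix S T assume "S \<in> U0" "S \<subseteq> T" "T \<subseteq> {1..n}"
      moreover have "T \<subseteq> {1..Suc n}" using \<open>T \<subseteq> {1..n}\<close> incr(1) by (rule order_trans)
      ultimately show "T \<in> U0" using U_up[of S T] by (simp add: U0_def)
    qed
    show "up_set n U1"
    proof (rule up_setI[OF sub(2)])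
      fix S T assume "S \<in> U1" and T: "S \<subseteq> T" "T \<subseteq> {1..n}"
      then have "insert (Suc n) S \<in> U" by (simp add: U1_def)
      moreover have "insert (Suc n) S \<subseteq> insert (Suc n) T" "insert (Suc n) T \<subseteq> {1..Suc n}"
        using T incr by auto
      ultimately have "insert (Suc n) T \<in> U" by (rule U_up)
      with T show "T \<in> U1" by (simp add: U1_def)
    qed
  qed
  have down: "down_set n D0" "down_set n D1"
  proof -
    show "down_set n D0"
    proof (rule down_setI[OF sub(3)])
      fix S T assume "S \<in> D0" "T \<subseteq> S"
      then show "T \<in> D0" using D_down[of S T] by (auto simp: D0_def)
    qed
    show "down_set n D1"
    proof (rule down_setI[OF sub(4)])
      fix S T assume "S \<in> D1" "T \<subseteq> S"
      then show "T \<in> D1"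
        using D_down[of "insert (Suc n) S" "insert (Suc n) T"] by (auto simp: D1_def)
    qed
  qed
  have "U0 \<subseteq> U1"
  proof
    fix S assume "S \<in> U0"
    then have "S \<in> U" "S \<subseteq> {1..n}" by (simp_all add: U0_def)
    moreover have "insert (Suc n) S \<subseteq> {1..Suc n}" using \<open>S \<subseteq> {1..n}\<close> incr by auto
    ultimately show "S \<in> U1" using U_up[of S "insert (Suc n) S"] by (auto simp: U1_def)
  qed
  moreover have "D1 \<subseteq> D0"
  proof
    fix S assume "S \<in> D1"
    then show "S \<in> D0" using D_down[of "insert (Suc n) S" S] by (auto simp: D0_def D1_def)
  qed
  moreover have "finite U1" "finite D0" by (fact finite_subset_Pow[OF sub(2)] finite_subset_Pow[OF sub(3)])+
  ultimately have le: "card U0 \<le> card U1" "card D1 \<le> card D0" by (simp_all add: card_mono)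
  have "card (U \<inter> D) = card (glue n (U0 \<inter> D0) (U1 \<inter> D1))"
    unfolding U D using sub by (simp add: glue_Int)
  also have "\<dots> = card (U0 \<inter> D0) + card (U1 \<inter> D1)"
    using sub by (intro card_glue) auto
  also have "\<dots> \<le> vdc n (card U0) (card D0) + vdc n (card U1) (card D1)"
    using up down by (intro add_mono Suc.IH)
  also have "\<dots> \<le> vdc (Suc n) (card U0 + card U1) (card D0 + card D1)"
    using le sub by (intro vdc_merge card_le_pow)
  also have "\<dots> = vdc (Suc n) (card U) (card D)"
    unfolding U D using sub by (simp add: card_glue)
  finally show ?case .
qed

section \<open>Extremal families\<close>

text \<open>Chains of up-sets and of down-sets that meet in \<open>vdc n a b\<close> sets for all \<open>a\<close> and \<open>b\<close> simultaneously.
  \<open>up_chain\<close> spreads its \<open>a\<close> members evenly over the two sections, whereas \<open>down_chain\<close> fills the section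
  without the last element completely before it uses the other one; it is the binary order in which the
  largest element is the leading digit.\<close>
fun up_chain :: "nat \<Rightarrow> nat \<Rightarrow> nat set set" where
  "up_chain 0 a = (if a = 0 then {} else {{}})"
| "up_chain (Suc n) a = glue n (up_chain n (a div 2)) (up_chain n ((a + 1) div 2))"

fun down_chain :: "nat \<Rightarrow> nat \<Rightarrow> nat set set" where
  "down_chain 0 b = (if b = 0 then {} else {{}})"
| "down_chain (Suc n) b = glue n (down_chain n b) (down_chain n (b - 2 ^ n))"

lemma up_chain_mono: "a \<le> a' \<Longrightarrow> up_chain n a \<subseteq> up_chain n a'"
proof (induction n arbitrary: a a')
  case (Suc n)
  show ?case unfolding up_chain.simps
    using Suc.prems by (intro glue_mono Suc.IH div_le_mono) simp_all
qed auto

lemma down_chain_mono: "b \<le> b' \<Longrightarrow> down_chain n b \<subseteq> down_chain n b'"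
proof (induction n arbitrary: b b')
  case (Suc n)
  show ?case unfolding down_chain.simps
    using Suc.prems by (intro glue_mono Suc.IH diff_le_mono)
qed auto

lemma up_set_up_chain: "up_set n (up_chain n a)"
proof (induction n arbitrary: a)
  case 0
  show ?case by (auto simp: up_set_def)
next
  case (Suc n)
  have "up_chain n (a div 2) \<subseteq> up_chain n ((a + 1) div 2)"
    by (intro up_chain_mono div_le_mono) simp
  then show ?case unfolding up_chain.simps by (intro up_set_glue Suc.IH)
qed

lemma down_set_down_chain: "down_set n (down_chain n b)"
proof (induction n arbitrary: b)
  case 0
  show ?case by (auto simp: down_set_def)
next
  case (Suc n)
  show ?case unfolding down_chain.simps by (intro down_set_glue Suc.IH down_chain_mono) simp
qed

lemmas up_chain_subset = up_set_subset[OF up_set_up_chain]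
  and down_chain_subset = down_set_subset[OF down_set_down_chain]

lemma card_up_chain: "a \<le> 2 ^ n \<Longrightarrow> card (up_chain n a) = a"
proof (induction n arbitrary: a)
  case (Suc n)
  have "a div 2 \<le> 2 ^ n" "(a + 1) div 2 \<le> 2 ^ n" using Suc.prems by auto
  then have "card (up_chain (Suc n) a) = a div 2 + (a + 1) div 2"
    by (simp only: up_chain.simps card_glue[OF up_chain_subset up_chain_subset] Suc.IH)
  then show ?case by presburger
qed auto

lemma card_down_chain: "card (down_chain n b) = min b (2 ^ n)"
proof (induction n arbitrary: b)
  case (Suc n)
  show ?case
    by (simp add: card_glue[OF down_chain_subset down_chain_subset] Suc.IH)
qed auto

lemma card_up_chain_Int_down_chain:
  "a \<le> 2 ^ n \<Longrightarrow> card (up_chain n a \<inter> down_chain n b) = vdc n a b"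
proof (induction n arbitrary: a b)
  case (Suc n)
  have "a div 2 \<le> 2 ^ n" "(a + 1) div 2 \<le> 2 ^ n" using Suc.prems by auto
  moreover have "card (glue n (up_chain n p \<inter> down_chain n b) (up_chain n q \<inter> down_chain n c)) =
      card (up_chain n p \<inter> down_chain n b) + card (up_chain n q \<inter> down_chain n c)" for p q c
    by (intro card_glue le_infI1 up_chain_subset)
  ultimately show ?case
    by (simp only: up_chain.simps down_chain.simps vdc.simps Suc.IH
        glue_Int[OF up_chain_subset up_chain_subset down_chain_subset down_chain_subset])
qed auto

lemma up_set_up_closure: "up_set n (up_closure n F)"
proof (rule up_setI)
  fix S T assume S: "S \<in> up_closure n F" and T: "S \<subseteq> T" "T \<subseteq> {1..n}"
  then obtain A where "A \<in> F" "A \<subseteq> T" by (auto simp: up_closure_def)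
  with T show "T \<in> up_closure n F" by (auto simp: up_closure_def)
qed (auto simp: up_closure_def)

lemma down_set_down_closure: "down_set n (down_closure n F)"
proof (rule down_setI)
  fix S T assume "S \<in> down_closure n F" and T: "T \<subseteq> S"
  then obtain A where "A \<in> F" "T \<subseteq> A" "T \<subseteq> {1..n}" by (auto simp: down_closure_def)
  then show "T \<in> down_closure n F" by (auto simp: down_closure_def)
qed (auto simp: down_closure_def)

lemmas up_closure_subset = up_set_subset[OF up_set_up_closure]
  and down_closure_subset = down_set_subset[OF down_set_down_closure]

section \<open>The minimum\<close>

text \<open>The least possible \<open>|U| + |D|\<close> for \<open>|U \<inter> D| \<ge> m\<close> is \<open>v + m\<close>: some pair of sizes attains it, and no
pair with a smaller sum reaches \<open>m\<close>. A family may have closures that meet in \<open>i > m\<close> sets, which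
decreases \<open>|U| + |D| - |U \<inter> D|\<close>; but raising the intersection by \<open>i - m\<close> raises the required sum by at
least as much, because \<open>env\<close> grows by at most one per step.\<close>

lemma Phi_eqI:
  assumes "m \<le> 2 ^ n"
    and attained: "\<exists>a b. a \<le> 2 ^ n \<and> b \<le> 2 ^ n \<and> a + b = v + m \<and> m \<le> vdc n a b"
    and below: "env n (v + m - 1) < m"
  shows "Phi n m = v"
proof -
  define X where "X = {card (updown_closure n F) | F. F \<subseteq> Pow {1..n} \<and> card F = m}"
  have fin: "finite X"
  proof (rule finite_subset)
    show "X \<subseteq> (\<lambda>F. card (updown_closure n F)) ` Pow (Pow {1..n})" by (auto simp: X_def)
  qed simp
  have card_updown: "card (updown_closure n F) + card (up_closure n F \<inter> down_closure n F) =
      card (up_closure n F) + card (down_closure n F)" for F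
    unfolding updown_closure_def
    by (rule card_Un_Int[symmetric, OF finite_subset_Pow[OF up_closure_subset]
          finite_subset_Pow[OF down_closure_subset]])
  have card_F: "card F \<le> card (up_closure n F \<inter> down_closure n F)" if "F \<subseteq> Pow {1..n}" for F
  proof (rule card_mono)
    show "finite (up_closure n F \<inter> down_closure n F)"
      by (intro finite_Int disjI1 finite_subset_Pow[OF up_closure_subset])
    show "F \<subseteq> up_closure n F \<inter> down_closure n F"
      using that by (auto simp: up_closure_def down_closure_def)
  qed
  have lower: "v \<le> card (updown_closure n F)" if F: "F \<subseteq> Pow {1..n}" "card F = m" for F
  proof -
    define a b i where "a = card (up_closure n F)" and "b = card (down_closure n F)"
      and "i = card (up_closure n F \<inter> down_closure n F)"
    have i: "m \<le> i" using card_F[OF F(1)] F(2) by (simp add: i_def)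
    have ab: "a \<le> 2 ^ n" "b \<le> 2 ^ n"
      using card_le_pow[OF up_closure_subset] card_le_pow[OF down_closure_subset]
      unfolding a_def b_def by auto
    have "i \<le> vdc n a b"
      unfolding i_def a_def b_def
      by (intro card_up_set_Int_down_set_le up_set_up_closure down_set_down_closure)
    also have "\<dots> \<le> env n (a + b)" by (rule vdc_le_env[OF ab])
    finally have i_le: "i \<le> env n (a + b)" .
    have "v + i \<le> a + b"
    proof (rule ccontr)
      assume "\<not> v + i \<le> a + b"
      then have "env n (a + b) \<le> env n (v + m - 1 + (i - m))"
        using i by (intro env_mono) auto
      also have "\<dots> \<le> env n (v + m - 1) + (i - m)" by (rule env_lipschitz)
      finally show False using below i i_le by linarith
    qed
    then show ?thesis using card_updown[of F] unfolding a_def b_def i_def by linarith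
  qed
  obtain a b where ab: "a \<le> 2 ^ n" "b \<le> 2 ^ n" "a + b = v + m" "m \<le> vdc n a b"
    using attained by blast
  have "m \<le> card (up_chain n a \<inter> down_chain n b)"
    using card_up_chain_Int_down_chain[OF ab(1)] ab(4) by simp
  then obtain F where F: "F \<subseteq> up_chain n a \<inter> down_chain n b" "card F = m"
    using obtain_subset_with_card_n by metis
  have F_sub: "F \<subseteq> Pow {1..n}" using F(1) up_chain_subset[of n a] by blast
  have "up_closure n F \<subseteq> up_chain n a"
  proof
    fix S assume "S \<in> up_closure n F"
    then obtain A where "A \<in> up_chain n a" "A \<subseteq> S" "S \<subseteq> {1..n}"
      using F(1) by (auto simp: up_closure_def)
    then show "S \<in> up_chain n a" by (rule up_setD[OF up_set_up_chain])
  qed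
  then have "card (up_closure n F) \<le> card (up_chain n a)"
    by (rule card_mono[OF finite_subset_Pow[OF up_chain_subset]])
  moreover have "down_closure n F \<subseteq> down_chain n b"
  proof
    fix S assume "S \<in> down_closure n F"
    then obtain A where "A \<in> down_chain n b" "S \<subseteq> A"
      using F(1) by (auto simp: down_closure_def)
    then show "S \<in> down_chain n b" by (rule down_setD[OF down_set_down_chain])
  qed
  then have "card (down_closure n F) \<le> card (down_chain n b)"
    by (rule card_mono[OF finite_subset_Pow[OF down_chain_subset]])
  moreover have "card (up_chain n a) = a" "card (down_chain n b) = b"
    using ab(1,2) by (simp_all add: card_up_chain card_down_chain)
  ultimately have "card (updown_closure n F) \<le> v"
    using card_updown[of F] card_F[OF F_sub] F(2) ab(3) by linarith
  with lower[OF F_sub F(2)] have "card (updown_closure n F) = v" by simp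
  then have "v \<in> X" unfolding X_def using F_sub F(2) by blast
  moreover have "v \<le> x" if "x \<in> X" for x using that lower by (auto simp: X_def)
  ultimately show ?thesis
    unfolding Phi_def X_def[symmetric] using fin by (intro Min_eqI) auto
qed

theorem theorem1p3:
  fixes n m \<kappa> c :: nat
  assumes "m \<in> {1..2 ^ n}"
    and "\<kappa> = (if even n then 1 else 2)"
    and "c > 0"
    and "\<kappa> * c * (c - 1) \<le> m"
    and "m < \<kappa> * c * (c + 1)"
  shows "real (Phi n m) =
    sqrt (real \<kappa> * 2 ^ n) *
      (2 * real c - 1 + 2 * real_of_rat (delta (2 * \<kappa> * c) (m - \<kappa> * c * (c - 1)))) - real m"
proof -
  define k e where "k = n div 2" and "e = n mod 2"
  define K where "K = (2::nat) ^ k"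
  have e: "e \<le> 1" and n: "n = 2 * k + e" by (auto simp: k_def e_def)
  have \<kappa>: "\<kappa> = 2 ^ e" using assms(2) by (auto simp: e_def even_iff_mod_2_eq_zero odd_iff_mod_2_eq_one)
  have \<kappa>0: "0 < \<kappa>" and K0: "0 < K" by (simp_all add: \<kappa> K_def)
  have pow_n: "2 ^ n = \<kappa> * K * K" by (simp add: n \<kappa> K_def power_add mult_2)
  have m: "1 \<le> m" "m \<le> \<kappa> * K * K" using assms(1) pow_n by auto

  \<comment> \<open>\<open>y\<close> is the argument of \<open>delta\<close>, located in the piece of length \<open>c\<close> with number \<open>j\<close>.\<close>
  define y j x where "y = m - \<kappa> * c * (c - 1)" and "j = y div c" and "x = y mod c"
  define d where "d = \<kappa> * (c - 1) + j"
  have y: "y = j * c + x" and x: "x < c" using assms(3) by (simp_all add: j_def x_def)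
  obtain c0 where c0: "c = Suc c0" using assms(3) gr0_implies_Suc by blast
  have "y < 2 * \<kappa> * c" using assms(4,5) by (simp add: y_def c0 algebra_simps)
  then have j: "j < 2 * \<kappa>" unfolding j_def by (simp add: less_mult_imp_div_less)
  have m_eq: "m = c * d + x"
    using assms(4) y unfolding y_def d_def c0 by (simp add: algebra_simps)
  have cd: "\<kappa> * c \<le> d + \<kappa>" "d < \<kappa> * c + \<kappa>" using j by (simp_all add: d_def c0)
  have cK: "c \<le> K"
  proof (rule ccontr)
    assume "\<not> c \<le> K"
    then have "K + 1 \<le> c" "K \<le> c - 1" by auto
    then have "\<kappa> * ((K + 1) * K) \<le> \<kappa> * (c * (c - 1))" by (intro mult_le_mono le_refl)
    also have "\<dots> \<le> \<kappa> * (K * K)"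
      using order_trans[OF assms(4) m(2)] by (simp only: mult.assoc)
    finally show False using \<kappa>0 K0 by simp
  qed
  obtain r where r: "r \<le> K" "of_nat r = of_nat K * delta c x" "\<And>b. x \<le> vdc k c b \<longleftrightarrow> r \<le> b"
    using delta_vdc_galois[of c k x] assms(3) cK x unfolding K_def by auto

  define a b where "a = c * (\<kappa> * K)" and "b = d * K + r"
  have pow_ke: "2 ^ (k + e) = \<kappa> * K" by (simp add: \<kappa> K_def power_add)
  have n': "n = k + (k + e)" using n by simp
  have a_le: "a \<le> 2 ^ n" unfolding a_def pow_n using cK by (simp add: mult.commute mult_le_mono)
  \<comment> \<open>The only delicate case is the full cube, \<open>m = 2 ^ n\<close>, where \<open>c = K\<close>, \<open>d = \<kappa> * K\<close> and \<open>r\<close> has to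
    vanish.\<close>
  have b_le: "b \<le> 2 ^ n"
  proof (cases "d < \<kappa> * K")
    case True
    then have "(d + 1) * K \<le> \<kappa> * K * K" by (intro mult_le_mono) auto
    then show ?thesis using r(1) unfolding b_def pow_n by simp
  next
    case False
    have "c = K"
    proof (rule ccontr)
      assume "c \<noteq> K"
      with cK have "\<kappa> * (c + 1) \<le> \<kappa> * K" by (intro mult_le_mono) auto
      with False cd show False by simp
    qed
    then have Kd: "K * d + x \<le> K * (\<kappa> * K)" using m(2) m_eq by (simp add: ac_simps)
    moreover have "K * (\<kappa> * K) \<le> K * d" using False by (intro mult_le_mono) auto
    ultimately have "x = 0" by linarith
    then have "r = 0" using r(3)[of 0] by simp
    have "K * d \<le> K * (\<kappa> * K)" using Kd by linarith
    then have "d \<le> \<kappa> * K" using K0 by (simp only: mult_le_cancel1)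
    then show ?thesis using \<open>r = 0\<close> unfolding b_def pow_n by simp
  qed
  have product: "vdc n a b = c * d + vdc k c r"
    using vdc_product[of d k r "k + e" c] b_le r(1)
    unfolding pow_ke n'[symmetric] a_def b_def K_def by simp
  have m_le: "m \<le> vdc n a b" using r(3)[of r] unfolding product m_eq by simp
  then have m_ab: "m \<le> a" "m \<le> b"
    using vdc_le_left[of n a b] vdc_le_right[OF a_le, of b] by auto
  define v where "v = a + b - m"
  have v: "a + b = v + m" using m_ab by (simp add: v_def)

  define q where "q = \<kappa> * c + d"
  have sum: "a + b = q * K + r" by (simp add: a_def b_def q_def algebra_simps)
  have sum_le: "q * K + r \<le> 2 ^ Suc n" using a_le b_le sum by simp
  have closed: "env n ((\<kappa> * c + d) * K + r) = c * d + vdc k c r"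
    if "\<kappa> * c \<le> d + \<kappa>" "d < \<kappa> * c + \<kappa>" "r \<le> K" "(\<kappa> * c + d) * K + r \<le> 2 ^ Suc n" for c d r
    using env_block[of e c d r k] that e unfolding n[symmetric] \<kappa>[symmetric] K_def[symmetric]
    by blast
  have below: "env n (v + m - 1) < m"
  proof (cases "r = 0")
    case False
    have "env n ((\<kappa> * c + d) * K + (r - 1)) = c * d + vdc k c (r - 1)"
      using cd r(1) sum_le unfolding q_def by (intro closed) auto
    moreover have "v + m - 1 = (\<kappa> * c + d) * K + (r - 1)"
      using v sum False unfolding q_def by simp
    moreover have "vdc k c (r - 1) < x" using r(3)[of "r - 1"] False by linarith
    ultimately show ?thesis by (simp add: m_eq)
  next
    \<comment> \<open>The sum is the left end of its block, so the preceding sum is the last but one point of the block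
      before, where \<open>vdc_less_left\<close> gives strictness. Going back one block either lowers \<open>d\<close>, or, at
      the first \<open>d\<close> admitted with \<open>c\<close>, lowers \<open>c\<close> and takes the last \<open>d\<close> admitted with \<open>c - 1\<close>.\<close>
    case True
    then have "x = 0" using r(3)[of 0] by simp
    then have d0: "0 < d" using m(1) m_eq by (cases d) auto
    obtain c' d' where cd': "q = \<kappa> * c' + d' + 1" "\<kappa> * c' \<le> d' + \<kappa>" "d' < \<kappa> * c' + \<kappa>"
      and m': "m = c' * d' + c'"
    proof (cases "\<kappa> * c < d + \<kappa>")
      case True
      then show ?thesis
        using d0 cd m_eq \<open>x = 0\<close> by (intro that[of c "d - 1"]) (auto simp: q_def algebra_simps)
    next
      case False
      with cd have "\<kappa> * c = d + \<kappa>" by simp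
      then have d: "d = \<kappa> * c0" by (simp add: c0)
      obtain \<kappa>' where "\<kappa> = Suc \<kappa>'" using \<kappa>0 gr0_implies_Suc by blast
      then show ?thesis
        using m_eq \<open>x = 0\<close> d
        by (intro that[of c0 "\<kappa> * c0 + \<kappa>'"]) (auto simp: q_def c0 algebra_simps)
    qed
    have c': "0 < c'" using m' m(1) by (cases c') auto
    have eq: "v + m - 1 = (\<kappa> * c' + d') * K + (K - 1)"
      using v sum True K0 unfolding cd'(1) by (simp add: algebra_simps)
    have "(\<kappa> * c' + d') * K + (K - 1) \<le> 2 ^ Suc n"
      using sum_le v sum unfolding eq[symmetric] by simp
    then have "env n (v + m - 1) = c' * d' + vdc k c' (K - 1)"
      unfolding eq using cd' by (intro closed) auto
    also have "\<dots> < c' * d' + c'"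
      using c' K0 by (intro add_strict_left_mono vdc_less_left) (auto simp: K_def)
    finally show ?thesis by (simp add: m')
  qed
  have "Phi n m = v"
    using assms(1) a_le b_le v m_le below by (intro Phi_eqI) auto

  moreover have "real v = real a + real b - real m" using v by simp
  moreover have "real a + real b = real (\<kappa> * K) *
      (2 * real c - 1 + 2 * real_of_rat (delta (2 * \<kappa> * c) y))"
  proof -
    have "2 * of_nat \<kappa> * delta (2 * \<kappa> * c) y = of_nat j + delta c x"
      using delta_multiple[OF e assms(3) _ x, of j] j by (simp add: \<kappa> y)
    then have "real_of_rat (2 * of_nat \<kappa> * delta (2 * \<kappa> * c) y) = real_of_rat (of_nat j + delta c x)"
      by simp
    then have 1: "2 * real \<kappa> * real_of_rat (delta (2 * \<kappa> * c) y) = real j + real_of_rat (delta c x)"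
      by (simp add: of_rat_mult of_rat_add)
    have "real_of_rat (of_nat r) = real_of_rat (of_nat K * delta c x)" using r(2) by simp
    then have 2: "real r = real K * real_of_rat (delta c x)" by (simp add: of_rat_mult)
    have 3: "real d = real \<kappa> * (real c - 1) + real j" by (simp add: d_def c0)
    have "real a + real b = real K * (real \<kappa> * real c + real d + real_of_rat (delta c x))"
      by (simp add: a_def b_def 2 algebra_simps)
    also have "\<dots> = real K * (real \<kappa> * (2 * real c - 1) +
        2 * real \<kappa> * real_of_rat (delta (2 * \<kappa> * c) y))"
      unfolding 1 3 by (simp add: algebra_simps)
    finally show ?thesis by (simp add: algebra_simps)
  qed
  moreover have "sqrt (real \<kappa> * 2 ^ n) = real (\<kappa> * K)"
  proof -
    have "(2::real) ^ n = real (\<kappa> * K * K)" by (simp flip: pow_n)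
    then have "real \<kappa> * 2 ^ n = (real (\<kappa> * K))\<^sup>2" by (simp add: power2_eq_square)
    then show ?thesis by simp
  qed
  ultimately show ?thesis by (simp add: y_def)
qed

end
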